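(* A monoid monomorphism $m\colon M\to A$ (where $m(M)$ is identified with $M$, so that $M$ is a submonoid of $A$) is a positive cone if one, and so all, of the following equivalent conditions is satisfied: (a) $M$ is the zero-class of some preorder; (b) $M$ is the zero-class of its syntactic $M$-preorder; (c) $M$ is the zero-class of the preorder $P(m)$; (d) $M$ is the zero-class of the smallest preorder whose zero-class contains $M$; (e) $m$ belongs to $\mathbf{Fix}(\eta_P)$, that is, $m$ is normal with respect to $\mathbf{Ord}(\mathbf{Mon})$; (f) $P(m)$ belongs to $\mathbf{Fix}(\varepsilon_P)$; (g) for every $x,y\in A$ and every $u\in M$, $xy\in M\Rightarrow xuy\in M$; (h) for every natural numbers $m,n\in\mathbb{N}$ and every two double indexed sequences $a_{ij}\in A$, $u_{ij}\in M$, with $i=1,\ldots,m$ and $j=1,\ldots,n$, if $$0=a_{11}+\ldots+a_{1n}$$ and $$\begin{aligned} a_{11}+u_{11}+\ldots+a_{1n}+u_{1n}&=a_{21}+\ldots+a_{2n}\\ &\;\;\vdots\\ a_{(i-1)1}+u_{(i-1)1}+\ldots+a_{(i-1)n}+u_{(i-1)n}&=a_{i1}+\ldots+a_{in}\\ &\;\;\vdots\\ a_{(m-1)1}+u_{(m-1)1}+\ldots+a_{(m-1)n}+u_{(m-1)n}&=a_{m1}+\ldots+a_{mn} \end{aligned}$$ then $$a_{m1}+u_{m1}+\ldots+a_{mn}+u_{mn}\in M.$$ (In (h) the letter $m$ denotes a natural number, not the monomorphism.)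
   Context: Monoids are not assumed commutative. The operation of $A$ is written multiplicatively with unit $1$, except in (h), where the same operation is written additively with unit $0$. Preorders on a monoid $A$ are internal: reflexive and transitive relations on $A$ that are submonoids of $A\times A$. The zero-class of a relation $S$ on $A$ is $[1]_S=\{u\in A\mid (1,u)\in S\}$; the zero-class of a preorder is called its positive cone. The syntactic $M$-preorder $\leq_M$ is defined by: $a\leq_M b$ if for every $x,y\in A$, $xay\in M\Rightarrow xby\in M$. $P(m)$ is the smallest preorder on $A$ whose zero-class contains $M$; it is the transitive closure of the submonoid of $A\times A$ generated by $(\{1\}\times M)\cup\Delta_A$, where $\Delta_A$ is the diagonal. $\mathbf{Mon}$ is the category of monoids. $\mathbf{Ord}(\mathbf{Mon})$ has as objects pairs $(A,S)$ with $S$ an internal preorder on the monoid $A$, and as morphisms the monoid homomorphisms preserving the relations. $\mathbf{Mono}(\mathbf{Mon})$ has as objects the monoid monomorphisms and as morphisms the commutative squares. The normalization functor $N\colon\mathbf{Ord}(\mathbf{Mon})\to\mathbf{Mono}(\mathbf{Mon})$ sends $(A,S)$ to the inclusion $[1]_S\to A$. The functor $P\colon\mathbf{Mono}(\mathbf{Mon})\to\mathbf{Ord}(\mathbf{Mon})$, sending $m$ to $A$ equipped with $P(m)$, is left adjoint to $N$, with unit $\eta_P$ and counit $\varepsilon_P$. $\mathbf{Fix}(\eta_P)$ is the full subcategory of $\mathbf{Mono}(\mathbf{Mon})$ of those $m$ for which the unit component $m\to N(P(m))$ is an isomorphism, and $\mathbf{Fix}(\varepsilon_P)$ is the full subcategory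 of $\mathbf{Ord}(\mathbf{Mon})$ of those $(A,S)$ for which the counit component $P(N(A,S))\to(A,S)$ is an isomorphism, i.e. those preorders that are generated by their zero-class (the smallest ones with that zero-class). A monomorphism $m\colon M\to A$ is normal with respect to $\mathbf{Ord}(\mathbf{Mon})$ if it is the pullback of some internal preorder $r\colon S\to A\times A$ on $A$ along $\langle 0,1\rangle\colon A\to A\times A$, $a\mapsto(1,a)$.
   Formalization: Condition (f) alone holds for every monomorphism m (P(m) is always generated by its zero-class), so it is not equivalent to the others; here (f) is taken together with the requirement that M be the zero-class of P(m), which makes it equivalent to (c). *)

theory Defs
  imports "HOL-Algebra.Group"
begin

section \<open>Monoids and internal preorders\<close>

text \<open>The library's \<^const>\<open>hom\<close> does not require the unit to be preserved.\<close>

definition monoid_hom :: "'a monoid \<Rightarrow> 'b monoid \<Rightarrow> ('a \<Rightarrow> 'b) set" where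
  "monoid_hom A B = {h \<in> hom A B. h \<one>\<^bsub>A\<^esub> = \<one>\<^bsub>B\<^esub>}"

definition monoid_mono :: "'a monoid \<Rightarrow> 'b monoid \<Rightarrow> ('a \<Rightarrow> 'b) set" where
  "monoid_mono A B = {h \<in> monoid_hom A B. inj_on h (carrier A)}"

definition internal_preorder :: "'a monoid \<Rightarrow> 'a rel \<Rightarrow> bool" where
  "internal_preorder A S \<longleftrightarrow> preorder_on (carrier A) S \<and> submonoid S (A \<times>\<times> A)"

definition zero_class :: "'a monoid \<Rightarrow> 'a rel \<Rightarrow> 'a set" where
  "zero_class A S = {u \<in> carrier A. (\<one>\<^bsub>A\<^esub>, u) \<in> S}"

definition positive_cone :: "'a monoid \<Rightarrow> 'a set \<Rightarrow> bool" where
  "positive_cone A M \<longleftrightarrow> (\<exists>S. internal_preorder A S \<and> M = zero_class A S)"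

definition syntactic_preorder :: "'a monoid \<Rightarrow> 'a set \<Rightarrow> 'a rel" where
  "syntactic_preorder A M = {(a, b) \<in> carrier A \<times> carrier A.
     \<forall>x \<in> carrier A. \<forall>y \<in> carrier A.
       x \<otimes>\<^bsub>A\<^esub> a \<otimes>\<^bsub>A\<^esub> y \<in> M \<longrightarrow> x \<otimes>\<^bsub>A\<^esub> b \<otimes>\<^bsub>A\<^esub> y \<in> M}"

definition generated_submonoid :: "'a monoid \<Rightarrow> 'a set \<Rightarrow> 'a set" where
  "generated_submonoid A X = \<Inter>{H. submonoid H A \<and> X \<subseteq> H}"

definition generated_preorder :: "'a monoid \<Rightarrow> 'a set \<Rightarrow> 'a rel" where
  "generated_preorder A M =
     (generated_submonoid (A \<times>\<times> A) ({\<one>\<^bsub>A\<^esub>} \<times> M \<union> Id_on (carrier A)))\<^sup>+"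

definition is_smallest_preorder_above :: "'a monoid \<Rightarrow> 'a set \<Rightarrow> 'a rel \<Rightarrow> bool" where
  "is_smallest_preorder_above A M S \<longleftrightarrow>
     internal_preorder A S \<and> M \<subseteq> zero_class A S \<and>
     (\<forall>T. internal_preorder A T \<and> M \<subseteq> zero_class A T \<longrightarrow> S \<subseteq> T)"

lemma generated_submonoid_submonoid:
  assumes "monoid A" "X \<subseteq> carrier A"
  shows "submonoid (generated_submonoid A X) A"
proof -
  interpret monoid A by fact
  have "submonoid (carrier A) A" by unfold_locales auto
  then have "generated_submonoid A X \<subseteq> carrier A"
    using assms(2) by (auto simp: generated_submonoid_def)
  then show ?thesis
    by (rule submonoid.intro)
      (auto simp: generated_submonoid_def intro: submonoid.m_closed submonoid.one_closed)
qed

lemma generated_preorder_smallest: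
  assumes A: "monoid A" and M: "M \<subseteq> carrier A"
  shows "is_smallest_preorder_above A M (generated_preorder A M)"
proof -
  interpret monoid A by fact
  let ?X = "{\<one>\<^bsub>A\<^esub>} \<times> M \<union> Id_on (carrier A)"
  let ?G = "generated_submonoid (A \<times>\<times> A) ?X"
  have sub: "submonoid ?G (A \<times>\<times> A)"
    using M by (intro generated_submonoid_submonoid DirProd_monoid A) auto
  have X: "?X \<subseteq> ?G" by (auto simp: generated_submonoid_def)
  have G: "?G \<subseteq> carrier A \<times> carrier A"
    using submonoid.subset[OF sub] by simp
  have Gmult: "(a \<otimes>\<^bsub>A\<^esub> c, b \<otimes>\<^bsub>A\<^esub> d) \<in> ?G" if "(a, b) \<in> ?G" "(c, d) \<in> ?G" for a b c d
    using submonoid.m_closed[OF sub that] by simp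
  have PG: "?G\<^sup>+ \<subseteq> carrier A \<times> carrier A"
    using G trancl_subset_Sigma by blast
  have left: "(a \<otimes>\<^bsub>A\<^esub> c, b \<otimes>\<^bsub>A\<^esub> c) \<in> ?G\<^sup>+" if "(a, b) \<in> ?G\<^sup>+" "c \<in> carrier A" for a b c
    using that(1)
  proof induction
    case (base b) then show ?case using Gmult[OF base, of c c] X that(2) by blast
  next
    case (step b d) then show ?case using Gmult[OF step(2), of c c] X that(2)
      by (meson Id_onI UnI2 subsetD trancl.trancl_into_trancl)
  qed
  have right: "(c \<otimes>\<^bsub>A\<^esub> a, c \<otimes>\<^bsub>A\<^esub> b) \<in> ?G\<^sup>+" if "(a, b) \<in> ?G\<^sup>+" "c \<in> carrier A" for a b c
    using that(1)
  proof induction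
    case (base b) then show ?case using Gmult[OF _ base, of c c] X that(2) by blast
  next
    case (step b d) then show ?case using Gmult[OF _ step(2), of c c] X that(2)
      by (meson Id_onI UnI2 subsetD trancl.trancl_into_trancl)
  qed
  have "submonoid (?G\<^sup>+) (A \<times>\<times> A)"
  proof
    show "?G\<^sup>+ \<subseteq> carrier (A \<times>\<times> A)" using PG by simp
    show "\<one>\<^bsub>A \<times>\<times> A\<^esub> \<in> ?G\<^sup>+" using submonoid.one_closed[OF sub] by (simp add: r_into_trancl)
    fix x y assume x: "x \<in> ?G\<^sup>+" and y: "y \<in> ?G\<^sup>+"
    obtain a b c d where xy: "x = (a, b)" "y = (c, d)" by (cases x, cases y)
    show "x \<otimes>\<^bsub>A \<times>\<times> A\<^esub> y \<in> ?G\<^sup>+"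
    proof -
      have ab: "(a, b) \<in> ?G\<^sup>+" and cd: "(c, d) \<in> ?G\<^sup>+" using x y xy by simp_all
      then have "c \<in> carrier A" "b \<in> carrier A" using PG by blast+
      then have "(a \<otimes>\<^bsub>A\<^esub> c, b \<otimes>\<^bsub>A\<^esub> d) \<in> ?G\<^sup>+"
        using left[OF ab] right[OF cd] by (meson trancl_trans)
      then show ?thesis by (simp add: xy)
    qed
  qed
  moreover have "refl_on (carrier A) (?G\<^sup>+)"
    using X by (auto simp: refl_on_def)
  ultimately have "internal_preorder A (?G\<^sup>+)"
    using PG by (auto simp: internal_preorder_def preorder_on_def)
  moreover have "M \<subseteq> zero_class A (?G\<^sup>+)"
    using X M by (auto simp: zero_class_def)
  moreover have "?G\<^sup>+ \<subseteq> T" if T: "internal_preorder A T" and MT: "M \<subseteq> zero_class A T" for T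
  proof -
    have "?G \<subseteq> T"
      using T MT unfolding generated_submonoid_def internal_preorder_def preorder_on_def
        refl_on_def zero_class_def by (intro Inter_lower) auto
    then have "?G\<^sup>+ \<subseteq> T\<^sup>+" by (rule trancl_mono_subset)
    then show ?thesis using T by (simp add: internal_preorder_def preorder_on_def trancl_id)
  qed
  ultimately show ?thesis
    unfolding is_smallest_preorder_above_def generated_preorder_def by (intro conjI allI impI; simp)
qed

text \<open>Products of finite sequences; the order of the factors matters.\<close>

definition mprod :: "'a monoid \<Rightarrow> 'a list \<Rightarrow> 'a" where
  "mprod A xs = foldr (\<otimes>\<^bsub>A\<^esub>) xs \<one>\<^bsub>A\<^esub>"


section \<open>The categories Mono(Mon) and Ord(Mon)\<close>

text \<open>An object \<open>(B, A, m)\<close> of Mono(Mon) is a monomorphism \<open>m\<close> from \<open>B\<close> to \<open>A\<close>; a morphism is a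
  pair of homomorphisms, between the domains and between the codomains. Maps are only meaningful
  on carriers, so identities of maps are required there only.\<close>

type_synonym ('b, 'a) mono_obj = "'b monoid \<times> 'a monoid \<times> ('b \<Rightarrow> 'a)"
type_synonym 'a ord_obj = "'a monoid \<times> 'a rel"

definition Mono_ob :: "('b, 'a) mono_obj set" where
  "Mono_ob = {(B, A, m). monoid B \<and> monoid A \<and> m \<in> monoid_mono B A}"

definition Mono_hom ::
  "('b, 'a) mono_obj \<Rightarrow> ('d, 'c) mono_obj \<Rightarrow> (('b \<Rightarrow> 'd) \<times> ('a \<Rightarrow> 'c)) set" where
  "Mono_hom = (\<lambda>(B, A, m) (B', A', m').
     {(f, g). f \<in> monoid_hom B B' \<and> g \<in> monoid_hom A A' \<and> (\<forall>b \<in> carrier B. m' (f b) = g (m b))})"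

definition Mono_iso ::
  "('b, 'a) mono_obj \<Rightarrow> ('d, 'c) mono_obj \<Rightarrow> (('b \<Rightarrow> 'd) \<times> ('a \<Rightarrow> 'c)) set" where
  "Mono_iso = (\<lambda>(B, A, m) (B', A', m').
     {(f, g) \<in> Mono_hom (B, A, m) (B', A', m').
        \<exists>(f', g') \<in> Mono_hom (B', A', m') (B, A, m).
          (\<forall>b \<in> carrier B. f' (f b) = b) \<and> (\<forall>b \<in> carrier B'. f (f' b) = b) \<and>
          (\<forall>a \<in> carrier A. g' (g a) = a) \<and> (\<forall>a \<in> carrier A'. g (g' a) = a)})"

definition Ord_ob :: "'a ord_obj set" where
  "Ord_ob = {(A, S). monoid A \<and> internal_preorder A S}"

definition Ord_hom :: "'a ord_obj \<Rightarrow> 'b ord_obj \<Rightarrow> ('a \<Rightarrow> 'b) set" where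
  "Ord_hom = (\<lambda>(A, S) (A', S').
     {f \<in> monoid_hom A A'. \<forall>(a, b) \<in> S. (f a, f b) \<in> S'})"

definition Ord_iso :: "'a ord_obj \<Rightarrow> 'b ord_obj \<Rightarrow> ('a \<Rightarrow> 'b) set" where
  "Ord_iso = (\<lambda>(A, S) (A', S').
     {f \<in> Ord_hom (A, S) (A', S').
        \<exists>f' \<in> Ord_hom (A', S') (A, S).
          (\<forall>a \<in> carrier A. f' (f a) = a) \<and> (\<forall>a \<in> carrier A'. f (f' a) = a)})"


section \<open>The adjunction between P and N\<close>

definition N_ob :: "'a ord_obj \<Rightarrow> ('a, 'a) mono_obj" where
  "N_ob = (\<lambda>(A, S). (A\<lparr>carrier := zero_class A S\<rparr>, A, \<lambda>a. a))"

definition P_ob :: "('b, 'a) mono_obj \<Rightarrow> 'a ord_obj" where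
  "P_ob = (\<lambda>(B, A, m). (A, generated_preorder A (m ` carrier B)))"

text \<open>The unit at \<open>m\<close> is the identity on codomains, and therefore \<open>m\<close> itself, corestricted to the
  zero-class, on domains. The counit is carried by the identity.\<close>

definition P_unit :: "('b, 'a) mono_obj \<Rightarrow> ('b \<Rightarrow> 'a) \<times> ('a \<Rightarrow> 'a)" where
  "P_unit = (\<lambda>(B, A, m). (m, \<lambda>a. a))"

definition P_counit :: "'a ord_obj \<Rightarrow> 'a \<Rightarrow> 'a" where
  "P_counit = (\<lambda>(A, S). \<lambda>a. a)"

definition Fix_unit :: "('b, 'a) mono_obj set" where
  "Fix_unit = {X \<in> Mono_ob. P_unit X \<in> Mono_iso X (N_ob (P_ob X))}"

definition Fix_counit :: "'a ord_obj set" where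
  "Fix_counit = {Y \<in> Ord_ob. P_counit Y \<in> Ord_iso (P_ob (N_ob Y)) Y}"

text \<open>Being in the image of \<open>P\<close> already implies membership in \<^const>\<open>Fix_counit\<close>. Hence
  \<open>P_ob (B, A, m) \<in> Fix_counit\<close> on its own puts no condition on \<open>m\<close>; it does once \<open>m\<close> is also
  required to be the zero-class by which the preorder is generated.\<close>

lemma P_ob_in_Fix_counit:
  assumes "X \<in> Mono_ob"
  shows "P_ob X \<in> Fix_counit"
proof -
  obtain B A m where X: "X = (B, A, m)" by (metis prod_cases3)
  define M where "M = m ` carrier B"
  have A: "monoid A" and M: "M \<subseteq> carrier A"
    using assms by (auto simp: X M_def Mono_ob_def monoid_mono_def monoid_hom_def hom_def)
  let ?S = "generated_preorder A M"
  let ?T = "generated_preorder A (zero_class A ?S)"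
  have S: "is_smallest_preorder_above A M ?S"
    using A M by (rule generated_preorder_smallest)
  have T: "is_smallest_preorder_above A (zero_class A ?S) ?T"
    using A by (rule generated_preorder_smallest) (auto simp: zero_class_def)
  have "?T = ?S"
  proof (rule antisym)
    show "?T \<subseteq> ?S" using S T by (simp add: is_smallest_preorder_above_def)
    show "?S \<subseteq> ?T" using S T unfolding is_smallest_preorder_above_def by (meson order_trans)
  qed
  then have "P_ob (N_ob (P_ob X)) = P_ob X"
    by (simp add: X P_ob_def N_ob_def M_def)
  moreover have "P_counit (P_ob X) \<in> Ord_iso (P_ob X) (P_ob X)"
    by (auto simp: X P_ob_def P_counit_def Ord_iso_def Ord_hom_def monoid_hom_def hom_def)
  moreover have "P_ob X \<in> Ord_ob"
    using S A by (simp add: X P_ob_def Ord_ob_def is_smallest_preorder_above_def M_def)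
  ultimately show ?thesis
    by (simp add: Fix_counit_def)
qed


section \<open>Normal monomorphisms\<close>

text \<open>The square formed by \<open>p\<close>, \<open>q\<close> (from \<open>T\<close>) and \<open>f\<close>, \<open>g\<close> (into \<open>Z\<close>) is a pullback of monoids
  if it commutes and the comparison map from \<open>T\<close> to the canonical pullback, a submonoid of
  \<open>X \<times>\<times> Y\<close>, is an isomorphism. The universal property with respect to test monoids over an
  arbitrary type is derived below.\<close>

definition is_pullback ::
  "'t monoid \<Rightarrow> ('t \<Rightarrow> 'x) \<Rightarrow> ('t \<Rightarrow> 'y) \<Rightarrow> 'x monoid \<Rightarrow> ('x \<Rightarrow> 'z) \<Rightarrow> 'y monoid \<Rightarrow> ('y \<Rightarrow> 'z)
     \<Rightarrow> 'z monoid \<Rightarrow> bool" where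
  "is_pullback T p q X f Y g Z \<longleftrightarrow>
     p \<in> monoid_hom T X \<and> q \<in> monoid_hom T Y \<and> f \<in> monoid_hom X Z \<and> g \<in> monoid_hom Y Z \<and>
     (\<forall>t \<in> carrier T. f (p t) = g (q t)) \<and>
     (\<lambda>t. (p t, q t)) \<in> iso T ((X \<times>\<times> Y)\<lparr>carrier := {(x, y) \<in> carrier X \<times> carrier Y. f x = g y}\<rparr>)"

lemma is_pullback_universal:
  assumes pb: "is_pullback T p q X f Y g Z" and T: "monoid T" and W: "monoid W"
    and h: "h \<in> monoid_hom W X" and k: "k \<in> monoid_hom W Y"
    and comm: "\<And>w. w \<in> carrier W \<Longrightarrow> f (h w) = g (k w)"
  shows "\<exists>l \<in> monoid_hom W T. \<forall>w \<in> carrier W. p (l w) = h w \<and> q (l w) = k w"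
    and "\<And>l l' w. \<lbrakk>l \<in> monoid_hom W T; l' \<in> monoid_hom W T; w \<in> carrier W;
           \<forall>w \<in> carrier W. p (l w) = h w \<and> q (l w) = k w;
           \<forall>w \<in> carrier W. p (l' w) = h w \<and> q (l' w) = k w\<rbrakk> \<Longrightarrow> l w = l' w"
proof -
  let ?E = "{(x, y) \<in> carrier X \<times> carrier Y. f x = g y}"
  let ?c = "\<lambda>t. (p t, q t)"
  have p: "p \<in> monoid_hom T X" and q: "q \<in> monoid_hom T Y"
    and bij: "bij_betw ?c (carrier T) ?E"
    using pb by (auto simp: is_pullback_def iso_def)
  have inj: "t = t'" if "t \<in> carrier T" "t' \<in> carrier T" "p t = p t'" "q t = q t'" for t t'
    using bij that by (auto simp: bij_betw_def inj_on_def)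
  define l where "l w = inv_into (carrier T) ?c (h w, k w)" for w
  have hk: "(h w, k w) \<in> ?E" if "w \<in> carrier W" for w
    using that h k comm by (auto simp: monoid_hom_def hom_def)
  have l: "l w \<in> carrier T" "p (l w) = h w" "q (l w) = k w" if "w \<in> carrier W" for w
    using bij_betw_inv_into_right[OF bij hk[OF that]]
      bij_betwE[OF bij_betw_inv_into[OF bij]] hk[OF that] by (auto simp: l_def)
  have "l \<in> monoid_hom W T"
    unfolding monoid_hom_def hom_def
  proof (intro CollectI conjI ballI funcsetI)
    fix v w assume vw: "v \<in> carrier W" "w \<in> carrier W"
    show "l (v \<otimes>\<^bsub>W\<^esub> w) = l v \<otimes>\<^bsub>T\<^esub> l w"
      using vw l p q h k monoid.m_closed[OF W] monoid.m_closed[OF T]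
      by (intro inj) (auto simp: monoid_hom_def hom_def)
  next
    show "l \<one>\<^bsub>W\<^esub> = \<one>\<^bsub>T\<^esub>"
      using l p q h k monoid.one_closed[OF W] monoid.one_closed[OF T]
      by (intro inj) (auto simp: monoid_hom_def)
  qed (use l in auto)
  then show "\<exists>l \<in> monoid_hom W T. \<forall>w \<in> carrier W. p (l w) = h w \<and> q (l w) = k w"
    using l by blast
  show "l w = l' w" if "l \<in> monoid_hom W T" "l' \<in> monoid_hom W T" "w \<in> carrier W"
    "\<forall>w \<in> carrier W. p (l w) = h w \<and> q (l w) = k w"
    "\<forall>w \<in> carrier W. p (l' w) = h w \<and> q (l' w) = k w" for l l' w
    using that by (intro inj) (auto simp: monoid_hom_def hom_def)
qed

definition normal_mono :: "('b, 'a) mono_obj \<Rightarrow> bool" where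
  "normal_mono = (\<lambda>(B, A, m). \<exists>S q. internal_preorder A S \<and>
     is_pullback B m q A (\<lambda>a. (\<one>\<^bsub>A\<^esub>, a)) ((A \<times>\<times> A)\<lparr>carrier := S\<rparr>) (\<lambda>s. s) (A \<times>\<times> A))"

end

theory Submission
  imports Defs
begin

text \<open>Everything reduces to condition (g), the stability of \<open>M\<close> under inserting its elements into
  products: it says exactly that \<open>M\<close> is contained in the zero-class of its syntactic preorder, and
  the reverse inclusion always holds since \<open>\<one> \<in> M\<close>. Conversely (g) follows from (h) for \<open>k = n = 2\<close>
  with first rows \<open>a = (\<one>, \<one>)\<close>, \<open>u = (\<one>, x y)\<close> and second rows \<open>a = (x, y)\<close>, \<open>u = (u, \<one>)\<close>.\<close>

section \<open>Elementwise rules for internal preorders\<close>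

lemma internal_preorder_mult:
  assumes "internal_preorder A S" "(a, b) \<in> S" "(c, d) \<in> S"
  shows "(a \<otimes>\<^bsub>A\<^esub> c, b \<otimes>\<^bsub>A\<^esub> d) \<in> S"
  using assms submonoid.m_closed[of S "A \<times>\<times> A" "(a, b)" "(c, d)"]
  by (simp add: internal_preorder_def)

lemma internal_preorder_refl:
  "internal_preorder A S \<Longrightarrow> a \<in> carrier A \<Longrightarrow> (a, a) \<in> S"
  by (simp add: internal_preorder_def preorder_on_def refl_on_def)

lemma internal_preorder_trans:
  "internal_preorder A S \<Longrightarrow> (a, b) \<in> S \<Longrightarrow> (b, c) \<in> S \<Longrightarrow> (a, c) \<in> S"
  unfolding internal_preorder_def preorder_on_def by (meson transD)

lemma internal_preorder_subset:
  "internal_preorder A S \<Longrightarrow> S \<subseteq> carrier A \<times> carrier A"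
  using submonoid.subset[of S "A \<times>\<times> A"] by (simp add: internal_preorder_def)

text \<open>Related factors multiply up along the list, starting from reflexivity at the unit for
  the empty product. Both products run over the same index list \<open>js\<close>, which keeps their
  factors matched in order; the rows of the staircase condition are of this form.\<close>

lemma internal_preorder_mprod:
  assumes "monoid A" "internal_preorder A S" "\<And>j. j \<in> set js \<Longrightarrow> (f j, g j) \<in> S"
  shows "(mprod A (map f js), mprod A (map g js)) \<in> S"
  using assms(3)
proof (induction js)
  case Nil
  then show ?case
    using assms(1,2) by (simp add: mprod_def internal_preorder_refl monoid.one_closed)
next
  case (Cons j js)
  then show ?case
    using internal_preorder_mult[OF assms(2)] by (simp add: mprod_def)
qed

section \<open>The syntactic preorder and stability under insertion\<close>

lemma syntactic_preorder_internal:
  assumes "monoid A"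
  shows "internal_preorder A (syntactic_preorder A M)"
proof -
  interpret monoid A by fact
  let ?S = "syntactic_preorder A M"
  have "preorder_on (carrier A) ?S"
    by (auto simp: preorder_on_def refl_on_def trans_def syntactic_preorder_def)
  moreover have "(a \<otimes>\<^bsub>A\<^esub> c, b \<otimes>\<^bsub>A\<^esub> d) \<in> ?S" if ab: "(a, b) \<in> ?S" and cd: "(c, d) \<in> ?S" for a b c d
  proof -
    have mem: "a \<in> carrier A" "b \<in> carrier A" "c \<in> carrier A" "d \<in> carrier A"
      using ab cd by (auto simp: syntactic_preorder_def)
    have "x \<otimes>\<^bsub>A\<^esub> (b \<otimes>\<^bsub>A\<^esub> d) \<otimes>\<^bsub>A\<^esub> y \<in> M"
      if xy: "x \<in> carrier A" "y \<in> carrier A" and "x \<otimes>\<^bsub>A\<^esub> (a \<otimes>\<^bsub>A\<^esub> c) \<otimes>\<^bsub>A\<^esub> y \<in> M" for x y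
    proof -
      \<comment> \<open>The two factors are exchanged one at a time: \<open>a\<close> for
        \<open>b\<close> in the context \<open>x\<close>, \<open>c y\<close>, then \<open>c\<close>
        for \<open>d\<close> in the context \<open>x b\<close>, \<open>y\<close>. Associativity only
        moves the brackets between these contexts.\<close>
      have "x \<otimes>\<^bsub>A\<^esub> a \<otimes>\<^bsub>A\<^esub> (c \<otimes>\<^bsub>A\<^esub> y) \<in> M"
        using that mem by (simp add: m_assoc)
      then have "x \<otimes>\<^bsub>A\<^esub> b \<otimes>\<^bsub>A\<^esub> (c \<otimes>\<^bsub>A\<^esub> y) \<in> M"
        using ab xy mem by (auto simp: syntactic_preorder_def)
      then have "(x \<otimes>\<^bsub>A\<^esub> b) \<otimes>\<^bsub>A\<^esub> c \<otimes>\<^bsub>A\<^esub> y \<in> M"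
        using xy mem by (simp add: m_assoc)
      then have "(x \<otimes>\<^bsub>A\<^esub> b) \<otimes>\<^bsub>A\<^esub> d \<otimes>\<^bsub>A\<^esub> y \<in> M"
        using cd xy mem by (auto simp: syntactic_preorder_def)
      then show ?thesis
        using xy mem by (simp add: m_assoc)
    qed
    then show ?thesis
      using mem by (auto simp: syntactic_preorder_def)
  qed
  then have "submonoid ?S (A \<times>\<times> A)"
    by unfold_locales (auto, auto simp: syntactic_preorder_def)
  ultimately show ?thesis
    by (simp add: internal_preorder_def)
qed

text \<open>Multiplying the pair \<open>(1, u)\<close> by the reflexive pairs \<open>(x, x)\<close>
  and \<open>(y, y)\<close> puts \<open>x y\<close> below \<open>x u y\<close>; transitivity then
  extends 1 below \<open>x y\<close> to 1 below \<open>x u y\<close>.\<close>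

lemma positive_cone_insert:
  assumes "monoid A" "positive_cone A M" "x \<in> carrier A" "y \<in> carrier A" "u \<in> M"
    and "x \<otimes>\<^bsub>A\<^esub> y \<in> M"
  shows "x \<otimes>\<^bsub>A\<^esub> u \<otimes>\<^bsub>A\<^esub> y \<in> M"
proof -
  interpret monoid A by fact
  obtain S where S: "internal_preorder A S" and M: "M = zero_class A S"
    using assms(2) by (auto simp: positive_cone_def)
  have u: "u \<in> carrier A" "(\<one>\<^bsub>A\<^esub>, u) \<in> S"
    using assms(5) by (auto simp: M zero_class_def)
  have "(x \<otimes>\<^bsub>A\<^esub> \<one>\<^bsub>A\<^esub> \<otimes>\<^bsub>A\<^esub> y, x \<otimes>\<^bsub>A\<^esub> u \<otimes>\<^bsub>A\<^esub> y) \<in> S"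
    using u assms(3,4) by (intro internal_preorder_mult[OF S] internal_preorder_refl[OF S])
  moreover have "(\<one>\<^bsub>A\<^esub>, x \<otimes>\<^bsub>A\<^esub> y) \<in> S"
    using assms(6) by (simp add: M zero_class_def)
  ultimately have "(\<one>\<^bsub>A\<^esub>, x \<otimes>\<^bsub>A\<^esub> u \<otimes>\<^bsub>A\<^esub> y) \<in> S"
    using assms(3) internal_preorder_trans[OF S] by simp
  then show ?thesis
    using u assms(3,4) by (simp add: M zero_class_def)
qed

lemma zero_class_syntactic_preorder:
  assumes "monoid A" "submonoid M A"
    and ins: "\<And>x y u. \<lbrakk>x \<in> carrier A; y \<in> carrier A; u \<in> M; x \<otimes>\<^bsub>A\<^esub> y \<in> M\<rbrakk> \<Longrightarrow> x \<otimes>\<^bsub>A\<^esub> u \<otimes>\<^bsub>A\<^esub> y \<in> M"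
  shows "M = zero_class A (syntactic_preorder A M)"
proof -
  interpret monoid A by fact
  interpret M: submonoid M A by fact
  show ?thesis
  proof (intro equalityI subsetI)
    fix u assume "u \<in> M"
    then show "u \<in> zero_class A (syntactic_preorder A M)"
      using M.subset by (auto simp: zero_class_def syntactic_preorder_def intro: ins)
  next
    fix u assume u: "u \<in> zero_class A (syntactic_preorder A M)"
    \<comment> \<open>For the reverse inclusion a single context is enough, the one with both sides
      equal to 1: there the premise is just that 1 lies in \<open>M\<close>.\<close>
    then have "\<one>\<^bsub>A\<^esub> \<otimes>\<^bsub>A\<^esub> \<one>\<^bsub>A\<^esub> \<otimes>\<^bsub>A\<^esub> \<one>\<^bsub>A\<^esub> \<in> M \<longrightarrow> \<one>\<^bsub>A\<^esub> \<otimes>\<^bsub>A\<^esub> u \<otimes>\<^bsub>A\<^esub> \<one>\<^bsub>A\<^esub> \<in> M"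
      unfolding zero_class_def syntactic_preorder_def using one_closed by blast
    then show "u \<in> M"
      using u M.one_closed by (simp add: zero_class_def)
  qed
qed

text \<open>Given stability under insertion, the syntactic preorder itself is the witness for
  \<open>positive_cone\<close>.\<close>

lemma positive_cone_iff_insert:
  assumes "monoid A" "submonoid M A"
  shows "positive_cone A M \<longleftrightarrow> (\<forall>x \<in> carrier A. \<forall>y \<in> carrier A. \<forall>u \<in> M.
           x \<otimes>\<^bsub>A\<^esub> y \<in> M \<longrightarrow> x \<otimes>\<^bsub>A\<^esub> u \<otimes>\<^bsub>A\<^esub> y \<in> M)"
proof
  assume "\<forall>x \<in> carrier A. \<forall>y \<in> carrier A. \<forall>u \<in> M. x \<otimes>\<^bsub>A\<^esub> y \<in> M \<longrightarrow> x \<otimes>\<^bsub>A\<^esub> u \<otimes>\<^bsub>A\<^esub> y \<in> M"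
  then have "M = zero_class A (syntactic_preorder A M)"
    by (intro zero_class_syntactic_preorder assms) blast
  then show "positive_cone A M"
    using syntactic_preorder_internal[OF assms(1)] unfolding positive_cone_def by blast
qed (use positive_cone_insert[OF assms(1)] in blast)

text \<open>An arbitrary witnessing preorder is never compared with the syntactic one; it serves
  only to supply stability under insertion.\<close>

lemma positive_cone_iff_syntactic:
  assumes "monoid A" "submonoid M A"
  shows "positive_cone A M \<longleftrightarrow> M = zero_class A (syntactic_preorder A M)"
proof
  assume "positive_cone A M"
  then show "M = zero_class A (syntactic_preorder A M)"
    using positive_cone_insert[OF assms(1)] by (intro zero_class_syntactic_preorder assms) blast
qed (use syntactic_preorder_internal[OF assms(1)] in \<open>unfold positive_cone_def, blast\<close>)

text \<open>Zero-classes grow with the relation. A preorder \<open>T\<close> with zero-class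
  \<open>M\<close> contains \<open>S\<close>, so the zero-class of \<open>S\<close> is squeezed
  between \<open>M\<close> and that of \<open>T\<close>. Leaving \<open>S\<close> arbitrary lets the
  same argument serve the generated preorder and the abstract description of the smallest
  one.\<close>

lemma positive_cone_iff_smallest:
  assumes "is_smallest_preorder_above A M S"
  shows "positive_cone A M \<longleftrightarrow> M = zero_class A S"
proof
  assume "positive_cone A M"
  then obtain T where T: "internal_preorder A T" "M = zero_class A T"
    by (auto simp: positive_cone_def)
  then have "S \<subseteq> T"
    using assms by (simp add: is_smallest_preorder_above_def)
  then have "zero_class A S \<subseteq> M"
    using T(2) by (auto simp: zero_class_def)
  then show "M = zero_class A S"
    using assms by (auto simp: is_smallest_preorder_above_def)
next
  assume "M = zero_class A S"
  then show "positive_cone A M"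
    using assms by (auto simp: is_smallest_preorder_above_def positive_cone_def)
qed

section \<open>Fixed points of the unit and normal monomorphisms\<close>

lemma submonoid_image_mono:
  assumes "monoid A" "monoid B" "m \<in> monoid_mono B A"
  shows "submonoid (m ` carrier B) A"
proof -
  interpret A: monoid A by fact
  interpret B: monoid B by fact
  have m: "m \<in> hom B A" "m \<one>\<^bsub>B\<^esub> = \<one>\<^bsub>A\<^esub>"
    using assms(3) by (auto simp: monoid_mono_def monoid_hom_def)
  show ?thesis
  proof
    show "m ` carrier B \<subseteq> carrier A"
      using m(1) by (auto simp: hom_def)
    show "\<one>\<^bsub>A\<^esub> \<in> m ` carrier B"
      using m(2) B.one_closed by (metis imageI)
    fix x y assume "x \<in> m ` carrier B" "y \<in> m ` carrier B"
    then obtain b c where "b \<in> carrier B" "c \<in> carrier B" "x = m b" "y = m c"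
      by auto
    then show "x \<otimes>\<^bsub>A\<^esub> y \<in> m ` carrier B"
      using hom_mult[OF m(1), of b c] B.m_closed by (metis imageI)
  qed
qed

text \<open>The unit is the identity on codomains, so only its domain component \<open>m\<close>,
  mapping into the zero-class, has to be inverted. An inverse there makes \<open>m\<close>
  surjective onto the zero-class; conversely, an injective homomorphism onto the zero-class has a
  homomorphic inverse.\<close>

lemma Fix_unit_iff_zero_class:
  assumes "monoid A" "monoid B" "m \<in> monoid_mono B A"
  shows "(B, A, m) \<in> Fix_unit \<longleftrightarrow>
    m ` carrier B = zero_class A (generated_preorder A (m ` carrier B))" (is "_ \<longleftrightarrow> _ = ?Z")
proof
  assume "(B, A, m) \<in> Fix_unit"
  then obtain f' where f': "f' \<in> monoid_hom (A\<lparr>carrier := ?Z\<rparr>) B" "\<forall>z \<in> ?Z. m (f' z) = z"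
    and m: "m \<in> monoid_hom B (A\<lparr>carrier := ?Z\<rparr>)"
    by (auto simp: Fix_unit_def Mono_iso_def Mono_hom_def P_unit_def N_ob_def P_ob_def)
  have "m ` carrier B \<subseteq> ?Z"
    using m by (auto simp: monoid_hom_def hom_def)
  moreover have "z \<in> m ` carrier B" if "z \<in> ?Z" for z
  proof -
    have "f' z \<in> carrier B"
      using f'(1) that by (auto simp: monoid_hom_def hom_def)
    then show ?thesis
      using f'(2) that by (metis imageI)
  qed
  ultimately show "m ` carrier B = ?Z" by blast
next
  assume Z: "m ` carrier B = ?Z"
  interpret B: monoid B by fact
  have m: "m \<in> hom B A" "m \<one>\<^bsub>B\<^esub> = \<one>\<^bsub>A\<^esub>" and inj: "inj_on m (carrier B)"
    using assms(3) by (auto simp: monoid_mono_def monoid_hom_def)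
  let ?C = "A\<lparr>carrier := m ` carrier B\<rparr>"
  \<comment> \<open>The candidate inverse; its values outside the image of \<open>m\<close> are
    arbitrary, which is harmless because maps are compared on carriers only.\<close>
  define f where "f = inv_into (carrier B) m"
  have f: "f (m b) = b" if "b \<in> carrier B" for b
    using that inj by (simp add: f_def)
  have "m \<in> monoid_hom B ?C"
    using m by (auto simp: monoid_hom_def hom_def)
  moreover have "f \<in> monoid_hom ?C B"
  proof -
    have "f (m b \<otimes>\<^bsub>A\<^esub> m c) = b \<otimes>\<^bsub>B\<^esub> c" if "b \<in> carrier B" "c \<in> carrier B" for b c
      using that hom_mult[OF m(1), of b c] f[of "b \<otimes>\<^bsub>B\<^esub> c"] by simp
    moreover have "f \<one>\<^bsub>A\<^esub> = \<one>\<^bsub>B\<^esub>"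
      using f[of "\<one>\<^bsub>B\<^esub>"] m(2) by simp
    ultimately show ?thesis
      using f by (auto simp: monoid_hom_def hom_def)
  qed
  moreover have "(\<lambda>a. a) \<in> monoid_hom A A"
    by (auto simp: monoid_hom_def hom_def)
  ultimately have "(m, \<lambda>a. a) \<in> Mono_iso (B, A, m) (?C, A, \<lambda>a. a)"
    unfolding Mono_iso_def Mono_hom_def using f
    by (auto intro!: exI[of _ f] exI[of _ "\<lambda>a. a"])
  \<comment> \<open>Reading \<open>Z\<close> from right to left replaces the zero-class by the image
    of \<open>m\<close>, so the isomorphism just found is the unit component itself.\<close>
  then show "(B, A, m) \<in> Fix_unit"
    using assms by (simp add: Fix_unit_def Mono_ob_def P_unit_def N_ob_def P_ob_def flip: Z)
qed

text \<open>The canonical pullback consists of the pairs \<open>(x, (1, x))\<close> with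
  \<open>(1, x)\<close> in \<open>S\<close>. Its first projection identifies it with the zero-class
  of \<open>S\<close>, so the pullback condition says that \<open>m\<close> maps bijectively onto
  that zero-class.\<close>

lemma normal_mono_iff_positive_cone:
  assumes "monoid A" "m \<in> monoid_mono B A"
  shows "normal_mono (B, A, m) \<longleftrightarrow> positive_cone A (m ` carrier B)"
proof
  assume "normal_mono (B, A, m)"
  then obtain S q where S: "internal_preorder A S"
    and bij: "bij_betw (\<lambda>b. (m b, q b)) (carrier B) {(x, s) \<in> carrier A \<times> S. (\<one>\<^bsub>A\<^esub>, x) = s}"
    unfolding normal_mono_def is_pullback_def iso_def by auto
  have "m ` carrier B = fst ` (\<lambda>b. (m b, q b)) ` carrier B"
    by (simp add: image_image)
  also have "\<dots> = zero_class A S"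
    unfolding bij_betw_imp_surj_on[OF bij] using internal_preorder_subset[OF S]
    by (auto simp: zero_class_def image_iff)
  finally show "positive_cone A (m ` carrier B)"
    using S by (auto simp: positive_cone_def)
next
  assume "positive_cone A (m ` carrier B)"
  then obtain S where S: "internal_preorder A S" and M: "m ` carrier B = zero_class A S"
    by (auto simp: positive_cone_def)
  interpret A: monoid A by fact
  have m: "m \<in> monoid_hom B A" and inj: "inj_on m (carrier B)"
    using assms(2) by (auto simp: monoid_mono_def)
  have mS: "m b \<in> carrier A" "(\<one>\<^bsub>A\<^esub>, m b) \<in> S" if "b \<in> carrier B" for b
    using M that by (auto simp: zero_class_def)
  \<comment> \<open>Commutativity of the square forces this second leg.\<close>
  let ?q = "\<lambda>b. (\<one>\<^bsub>A\<^esub>, m b)"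
  let ?E = "{(x, s) \<in> carrier A \<times> S. (\<one>\<^bsub>A\<^esub>, x) = s}"
  have "bij_betw (\<lambda>b. (m b, ?q b)) (carrier B) ?E"
  proof -
    have "(x, s) \<in> (\<lambda>b. (m b, ?q b)) ` carrier B" if "(x, s) \<in> ?E" for x s
      using that M by (auto simp: zero_class_def image_iff set_eq_iff)
    then show ?thesis
      using inj mS by (auto simp: bij_betw_def inj_on_def)
  qed
  then have "is_pullback B m ?q A (\<lambda>a. (\<one>\<^bsub>A\<^esub>, a)) ((A \<times>\<times> A)\<lparr>carrier := S\<rparr>) (\<lambda>s. s) (A \<times>\<times> A)"
    using m mS internal_preorder_subset[OF S]
    by (auto simp: is_pullback_def monoid_hom_def hom_def iso_def)
  then show "normal_mono (B, A, m)"
    using S by (auto simp: normal_mono_def)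
qed

section \<open>The staircase of equations\<close>

text \<open>Within row \<open>i\<close>, the product \<open>?p i\<close> without insertions lies
  below the product \<open>?q i\<close> with them. The equations identify \<open>?q i\<close> with
  \<open>?p (i + 1)\<close>, so the rows form a chain in \<open>S\<close> that starts at
  \<open>?p 1 = 1\<close> and ends at \<open>?q k\<close>.\<close>

lemma zero_class_staircase:
  assumes A: "monoid A" and S: "internal_preorder A S"
    and au: "\<And>i j. \<lbrakk>i \<in> {1..k}; j \<in> {1..n}\<rbrakk> \<Longrightarrow> a i j \<in> carrier A \<and> u i j \<in> zero_class A S"
    and first: "\<one>\<^bsub>A\<^esub> = mprod A (map (a 1) [1..<Suc n])"
    and step: "\<And>i. i \<in> {2..k} \<Longrightarrow> mprod A (map (\<lambda>j. a (i - 1) j \<otimes>\<^bsub>A\<^esub> u (i - 1) j) [1..<Suc n])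
                 = mprod A (map (a i) [1..<Suc n])"
    and k: "(1::nat) \<le> k"
  shows "mprod A (map (\<lambda>j. a k j \<otimes>\<^bsub>A\<^esub> u k j) [1..<Suc n]) \<in> zero_class A S"
proof -
  interpret monoid A by fact
  let ?p = "\<lambda>i. mprod A (map (a i) [1..<Suc n])"
  let ?q = "\<lambda>i. mprod A (map (\<lambda>j. a i j \<otimes>\<^bsub>A\<^esub> u i j) [1..<Suc n])"
  have row: "(?p i, ?q i) \<in> S" if "i \<in> {1..k}" for i
  proof (rule internal_preorder_mprod[OF A S])
    fix j assume "j \<in> set [1..<Suc n]"
    then have a: "a i j \<in> carrier A" and "(\<one>\<^bsub>A\<^esub>, u i j) \<in> S"
      using au[OF that, of j] by (auto simp: zero_class_def)
    then have "(a i j \<otimes>\<^bsub>A\<^esub> \<one>\<^bsub>A\<^esub>, a i j \<otimes>\<^bsub>A\<^esub> u i j) \<in> S"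
      by (intro internal_preorder_mult[OF S] internal_preorder_refl[OF S])
    then show "(a i j, a i j \<otimes>\<^bsub>A\<^esub> u i j) \<in> S"
      using a by simp
  qed
  \<comment> \<open>The bound \<open>i \<le> k\<close> stays inside the induction formula because
    nothing is assumed about rows beyond \<open>k\<close>.\<close>
  have "i \<le> k \<longrightarrow> (\<one>\<^bsub>A\<^esub>, ?q i) \<in> S" if "1 \<le> i" for i
    using that
  proof (induction i rule: dec_induct)
    case base
    then show ?case using row[of 1] first by auto
  next
    case (step i)
    show ?case
    proof
      assume i: "Suc i \<le> k"
      \<comment> \<open>Each equation is indexed by its right-hand row, so the passage from row
        \<open>i\<close> to the next is the one at \<open>Suc i\<close>.\<close>
      then have "?q i = ?p (Suc i)"
        using assms(5)[of "Suc i"] step.hyps by simp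
      then show "(\<one>\<^bsub>A\<^esub>, ?q (Suc i)) \<in> S"
        using step.IH row[of "Suc i"] i internal_preorder_trans[OF S]
        by (metis Suc_leD atLeastAtMost_iff le_add1 plus_1_eq_Suc)
    qed
  qed
  then have "(\<one>\<^bsub>A\<^esub>, ?q k) \<in> S" using k by simp
  then show ?thesis
    using internal_preorder_subset[OF S] by (auto simp: zero_class_def)
qed

lemma positive_cone_iff_staircase:
  assumes A: "monoid A" and sub: "submonoid M A"
  shows "positive_cone A M \<longleftrightarrow> (\<forall>(k::nat) (n::nat) (a :: nat \<Rightarrow> nat \<Rightarrow> 'a) (u :: nat \<Rightarrow> nat \<Rightarrow> 'a).
            k \<ge> 1
            \<and> (\<forall>i \<in> {1..k}. \<forall>j \<in> {1..n}. a i j \<in> carrier A \<and> u i j \<in> M)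
            \<and> \<one>\<^bsub>A\<^esub> = mprod A (map (a 1) [1..<Suc n])
            \<and> (\<forall>i \<in> {2..k}. mprod A (map (\<lambda>j. a (i - 1) j \<otimes>\<^bsub>A\<^esub> u (i - 1) j) [1..<Suc n])
                            = mprod A (map (a i) [1..<Suc n]))
            \<longrightarrow> mprod A (map (\<lambda>j. a k j \<otimes>\<^bsub>A\<^esub> u k j) [1..<Suc n]) \<in> M)"
    (is "_ \<longleftrightarrow> ?H")
proof
  assume "positive_cone A M"
  then obtain S where S: "internal_preorder A S" and M: "M = zero_class A S"
    by (auto simp: positive_cone_def)
  show ?H
    unfolding M by (intro allI impI, elim conjE, rule zero_class_staircase[OF A S]) blast+
next
  assume H: ?H
  interpret monoid A by fact
  interpret M: submonoid M A by fact
  have "x \<otimes>\<^bsub>A\<^esub> u \<otimes>\<^bsub>A\<^esub> y \<in> M"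
    if x: "x \<in> carrier A" and y: "y \<in> carrier A" and u: "u \<in> M" and xy: "x \<otimes>\<^bsub>A\<^esub> y \<in> M" for x y u
  proof -
    \<comment> \<open>Row 1 climbs from 1 to \<open>x y\<close>, with \<open>x y\<close> itself as
      an inserted element of \<open>M\<close>; row 2 splits that product into the factors
      \<open>x\<close>, \<open>y\<close> and inserts \<open>u\<close> after \<open>x\<close>. All
      other slots receive 1. Indices other than 1 share the second case, so the memberships hold for
      all \<open>i\<close> and \<open>j\<close>.\<close>
    define a where "a i j = (if i = 1 then \<one>\<^bsub>A\<^esub> else if j = 1 then x else y)" for i j :: nat
    define v where "v i j = (if i = 1 then (if j = 1 then \<one>\<^bsub>A\<^esub> else x \<otimes>\<^bsub>A\<^esub> y)
                             else if j = 1 then u else \<one>\<^bsub>A\<^esub>)" for i j :: nat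
    have u': "u \<in> carrier A" using u M.subset by blast
    have two: "[1..<Suc 2] = [1, 2]" by (simp add: upt_rec)
    have "mprod A (map (\<lambda>j. a 2 j \<otimes>\<^bsub>A\<^esub> v 2 j) [1..<Suc 2]) \<in> M"
    proof (intro H[rule_format] conjI ballI)
      show "\<one>\<^bsub>A\<^esub> = mprod A (map (a 1) [1..<Suc 2])"
        unfolding two by (simp add: mprod_def a_def)
      show "a i j \<in> carrier A" "v i j \<in> M" for i j
        using x y u xy by (simp_all add: a_def v_def)
      \<comment> \<open>The only equation, at \<open>i = 2\<close>: both sides reduce to
        \<open>x y\<close>.\<close>
      show "mprod A (map (\<lambda>j. a (i - 1) j \<otimes>\<^bsub>A\<^esub> v (i - 1) j) [1..<Suc 2])
              = mprod A (map (a i) [1..<Suc 2])" if "i \<in> {2..2}" for i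
        unfolding two using that x y by (simp add: mprod_def a_def v_def)
    qed simp
    then show ?thesis
      unfolding two using x y u' by (simp add: mprod_def a_def v_def m_assoc)
  qed
  then show "positive_cone A M"
    using positive_cone_iff_insert[OF A sub] by blast
qed

section \<open>Assembling the equivalences\<close>

theorem theorem3:
  fixes A :: "'a monoid" and B :: "'b monoid" and m :: "'b \<Rightarrow> 'a" and M :: "'a set"
  assumes "monoid A" and "monoid B" and "m \<in> monoid_mono B A"
    and "M = m ` carrier B"
  shows
    "(positive_cone A M \<longleftrightarrow> M = zero_class A (syntactic_preorder A M))
   \<and> (positive_cone A M \<longleftrightarrow> M = zero_class A (generated_preorder A M))
   \<and> (positive_cone A M \<longleftrightarrow> (\<exists>S. is_smallest_preorder_above A M S \<and> M = zero_class A S))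
   \<and> (positive_cone A M \<longleftrightarrow> (B, A, m) \<in> Fix_unit)
   \<and> (positive_cone A M \<longleftrightarrow> normal_mono (B, A, m))
   \<and> (positive_cone A M \<longleftrightarrow>
            P_ob (B, A, m) \<in> Fix_counit \<and> M = zero_class A (generated_preorder A M))
   \<and> (positive_cone A M \<longleftrightarrow> (\<forall>x \<in> carrier A. \<forall>y \<in> carrier A. \<forall>u \<in> M.
            x \<otimes>\<^bsub>A\<^esub> y \<in> M \<longrightarrow> x \<otimes>\<^bsub>A\<^esub> u \<otimes>\<^bsub>A\<^esub> y \<in> M))
   \<and> (positive_cone A M \<longleftrightarrow> (\<forall>(k::nat) (n::nat) (a :: nat \<Rightarrow> nat \<Rightarrow> 'a) (u :: nat \<Rightarrow> nat \<Rightarrow> 'a).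
            k \<ge> 1
            \<and> (\<forall>i \<in> {1..k}. \<forall>j \<in> {1..n}. a i j \<in> carrier A \<and> u i j \<in> M)
            \<and> \<one>\<^bsub>A\<^esub> = mprod A (map (a 1) [1..<Suc n])
            \<and> (\<forall>i \<in> {2..k}. mprod A (map (\<lambda>j. a (i - 1) j \<otimes>\<^bsub>A\<^esub> u (i - 1) j) [1..<Suc n])
                            = mprod A (map (a i) [1..<Suc n]))
            \<longrightarrow> mprod A (map (\<lambda>j. a k j \<otimes>\<^bsub>A\<^esub> u k j) [1..<Suc n]) \<in> M))"
proof -
  have sub: "submonoid M A"
    using submonoid_image_mono[OF assms(1-3)] by (simp add: assms(4))
  have smallest: "is_smallest_preorder_above A M (generated_preorder A M)"
    using assms(1) submonoid.subset[OF sub] by (rule generated_preorder_smallest)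
  note generated = positive_cone_iff_smallest[OF smallest]
  have "positive_cone A M \<longleftrightarrow> (\<exists>S. is_smallest_preorder_above A M S \<and> M = zero_class A S)"
    \<comment> \<open>The generated preorder provides existence; in the other direction any smallest
      preorder will do.\<close>
    using smallest positive_cone_iff_smallest by blast
  moreover have "positive_cone A M \<longleftrightarrow> (B, A, m) \<in> Fix_unit"
    using Fix_unit_iff_zero_class[OF assms(1-3)] generated by (simp add: assms(4))
  moreover have "positive_cone A M \<longleftrightarrow> normal_mono (B, A, m)"
    using normal_mono_iff_positive_cone[OF assms(1,3)] by (simp add: assms(4))
  \<comment> \<open>This holds for every monomorphism, so the condition through
    \<open>Fix_counit\<close> follows from \<open>generated\<close>.\<close>
  moreover have "P_ob (B, A, m) \<in> Fix_counit"
    using assms by (intro P_ob_in_Fix_counit) (simp add: Mono_ob_def)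
  ultimately show ?thesis
    using generated positive_cone_iff_syntactic[OF assms(1) sub]
      positive_cone_iff_insert[OF assms(1) sub] positive_cone_iff_staircase[OF assms(1) sub]
    by (intro conjI) blast+
qed

end
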